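(* Let $(X,d)$ be a compact metric space and let $(X,\mathcal{A},\mu,T)$ be a probability measure-preserving dynamical system. Suppose that $T$ is exponentially mixing with respect to $\mu$. Let $\psi:\mathbb{N}\to\mathbb{R}_{\ge 0}$ be a function, let $x_0\in X$, for $n\in\mathbb{N}$ put $B_n:=B(x_0,\psi(n))$, and let $$W(T,\psi):=\{x\in X: T^n x\in B_n \text{ for infinitely many } n\in\mathbb{N}\}.$$ Then $$\mu\big(W(T,\psi)\big)=\begin{cases}0 & \text{if } \sum_{n=1}^\infty\mu(B_n)<\infty,\\[1ex] 1 & \text{if } \sum_{n=1}^\infty\mu(B_n)=\infty.\end{cases}$$
   Context: $(X,\mathcal{A},\mu,T)$ being a probability measure-preserving dynamical system means that $\mu$ is a probability measure on the $\sigma$-algebra $\mathcal{A}$ (which contains the Borel sets, so in particular all balls, of the compact metric space $(X,d)$), and $T:X\to X$ is measurable with $\mu(T^{-1}F)=\mu(F)$ for all $F\in\mathcal{A}$. $B(x,r)$ denotes the ball with centre $x\in X$ and radius $r\ge 0$ (open or closed, with the same convention used throughout), and $\mathbb{N}=\{1,2,\dots\}$. $T$ is exponentially mixing with respect to $\mu$ if there exist constants $C>0$ and $\gamma\in(0,1)$ such that $$\big|\mu(B\cap T^{-n}F)-\mu(F)\mu(B)\big|\le C\,\gamma^n\,\mu(F)\qquad\text{for all } n\in\mathbb{N},$$ for all balls $B$ in $X$ and all $\mu$-measurable sets $F$ in $X$. *)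

theory Defs
  imports "HOL-Probability.Probability"
begin

text \<open>
  A metric space is a carrier \<open>X\<close> with a distance \<open>d\<close> (library locale \<open>Metric_space\<close>).
  Balls may be open or closed, with one convention throughout; accordingly \<open>bl\<close> below stands
  for the function taking a centre and a radius to a ball, and is meant to be either
  \<open>Metric_space.mball X d\<close> or \<open>Metric_space.mcball X d\<close>.
\<close>

definition pmp_system :: "'a measure \<Rightarrow> ('a \<Rightarrow> 'a) \<Rightarrow> bool" where
  "pmp_system M T \<longleftrightarrow>
     prob_space M \<and> T \<in> measurable M M \<and>
     (\<forall>F\<in>sets M. measure M (T -` F \<inter> space M) = measure M F)"

definition exponentially_mixing ::
    "('a \<Rightarrow> real \<Rightarrow> 'a set) \<Rightarrow> 'a measure \<Rightarrow> ('a \<Rightarrow> 'a) \<Rightarrow> bool" where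
  "exponentially_mixing bl M T \<longleftrightarrow>
     (\<exists>C \<gamma>. C > 0 \<and> 0 < \<gamma> \<and> \<gamma> < 1 \<and>
        (\<forall>n\<ge>1. \<forall>x\<in>space M. \<forall>r\<ge>0. \<forall>F\<in>sets M.
           \<bar>measure M (bl x r \<inter> ((T ^^ n) -` F \<inter> space M)) - measure M F * measure M (bl x r)\<bar>
             \<le> C * \<gamma> ^ n * measure M F))"

definition shrinking_target_set ::
    "('a \<Rightarrow> real \<Rightarrow> 'a set) \<Rightarrow> 'a set \<Rightarrow> ('a \<Rightarrow> 'a) \<Rightarrow> 'a \<Rightarrow> (nat \<Rightarrow> real) \<Rightarrow> 'a set" where
  "shrinking_target_set bl X T x0 \<psi> =
     {x \<in> X. infinite {n. n \<ge> 1 \<and> (T ^^ n) x \<in> bl x0 (\<psi> n)}}"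

end

theory Submission
  imports Defs
begin

text \<open>
  Put \<open>A\<^sub>n = T\<^sup>-\<^sup>n B\<^sub>n\<close>, so that \<open>W\<close> is the event that infinitely many \<open>A\<^sub>n\<close> occur, and
  \<open>\<mu>(A\<^sub>n) = \<mu>(B\<^sub>n)\<close> by invariance. If the measures are summable, the first Borel--Cantelli lemma
  makes \<open>W\<close> a null set.

  In the divergent case the events \<open>A\<^sub>n\<close> are not independent, but nearly so. For \<open>m < n\<close>
  invariance under \<open>T\<^sup>m\<close> gives \<open>\<mu>(A\<^sub>m \<inter> A\<^sub>n) = \<mu>(B\<^sub>m \<inter> T\<^bsup>-(n-m)\<^esup> B\<^sub>n)\<close>, and mixing bounds this by
  \<open>\<mu>(A\<^sub>m) \<mu>(A\<^sub>n) + C \<gamma>\<^bsup>n-m\<^esup> \<mu>(A\<^sub>n)\<close>. The decisive feature is that the error carries the factor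
  \<open>\<mu>(A\<^sub>n)\<close>: summed over \<open>m\<close> it is at most a constant multiple of \<open>\<mu>(A\<^sub>n)\<close>, so the number \<open>S\<^sub>N\<close>
  of events among the first \<open>N\<close> has variance of order at most its expectation \<open>E\<^sub>N\<close>
  (\<open>variance_count_le\<close>). As \<open>E\<^sub>N \<rightarrow> \<infinity>\<close>, Chebyshev's inequality bounds the probability of
  \<open>S\<^sub>N \<le> E\<^sub>N / 2\<close> by \<open>O(1 / E\<^sub>N)\<close>. Hence the total count exceeds every bound almost surely, which is
  the Borel--Cantelli lemma \<open>borel_cantelli_summable_correlation\<close>.
\<close>

section \<open>A second Borel--Cantelli lemma for weakly correlated events\<close>

lemma (in prob_space) integrable_count_squared:
  fixes A :: "nat \<Rightarrow> 'a set"
  assumes [measurable]: "\<And>n. A n \<in> events"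
  shows "integrable M (\<lambda>x. (\<Sum>n<N. indicator (A n) x :: real)\<^sup>2)" (is "integrable M (\<lambda>x. (?S N x)\<^sup>2)")
proof (rule integrable_const_bound[of _ "(real N)\<^sup>2"])
  have "0 \<le> ?S N x \<and> ?S N x \<le> real N" for x
    using sum_mono[of "{..<N}" "\<lambda>n. indicator (A n) x :: real" "\<lambda>_. 1"]
    by (auto intro: sum_nonneg simp: indicator_le_1)
  then show "AE x in M. norm ((?S N x)\<^sup>2) \<le> (real N)\<^sup>2"
    by (auto intro!: AE_I2 power_mono)
qed measurable

text \<open>
  Since the error \<open>c (n - m) P(A n)\<close> depends on \<open>m\<close> only through the gap, its sum over all
  \<open>m < n\<close> is at most \<open>\<Sum>c\<close> times \<open>P(A n)\<close>, whatever \<open>n\<close> is. Write \<open>S\<^sub>N\<close> for the number of events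
  among the first \<open>N\<close> and \<open>E\<^sub>N\<close> for its expectation. By induction on \<open>N\<close>: the second moment grows in step \<open>N\<close> by
  \<open>2 E(S\<^sub>N 1\<^bsub>A N\<^esub>) + P(A N)\<close>, and the correlation hypothesis bounds the mixed term by
  \<open>(E\<^sub>N + \<Sum>c) P(A N)\<close>.
\<close>

lemma (in prob_space) second_moment_count_le:
  fixes A :: "nat \<Rightarrow> 'a set" and c :: "nat \<Rightarrow> real"
  assumes A [measurable]: "\<And>n. A n \<in> events"
    and c: "summable c" "\<And>k. c k \<ge> 0"
    and corr: "\<And>m n. m < n \<Longrightarrow> prob (A m \<inter> A n) \<le> prob (A m) * prob (A n) + c (n - m) * prob (A n)"
  shows "expectation (\<lambda>x. (\<Sum>n<N. indicator (A n) x)\<^sup>2)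
    \<le> (\<Sum>n<N. prob (A n))\<^sup>2 + (1 + 2 * suminf c) * (\<Sum>n<N. prob (A n))"
proof (induction N)
  case (Suc N)
  let ?S = "\<lambda>N x. (\<Sum>n<N. indicator (A n) x) :: real"
  let ?E = "\<Sum>n<N. prob (A n)"
  have [simp]: "integrable M (\<lambda>x. indicator (A n) x :: real)" for n
    by (rule integrable_real_indicator) (auto simp: emeasure_eq_measure)
  have [simp]: "integrable M (\<lambda>x. indicator (A m \<inter> A n) x :: real)" for m n
    by (rule integrable_real_indicator) (auto simp: emeasure_eq_measure)
  have int_sq: "integrable M (\<lambda>x. (?S N x)\<^sup>2)"
    using A by (rule integrable_count_squared)
  have "(?S (Suc N) x)\<^sup>2 = (?S N x)\<^sup>2 + 2 * (\<Sum>m<N. indicator (A m \<inter> A N) x) + indicator (A N) x" for x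
    by (simp add: power2_sum indicator_inter_arith sum_distrib_right[symmetric])
      (simp add: power2_eq_square indicator_def)
  then have "expectation (\<lambda>x. (?S (Suc N) x)\<^sup>2)
      = expectation (\<lambda>x. (?S N x)\<^sup>2 + 2 * (\<Sum>m<N. indicator (A m \<inter> A N) x) + indicator (A N) x)"
    by presburger
  also have "\<dots> = expectation (\<lambda>x. (?S N x)\<^sup>2) + 2 * (\<Sum>m<N. prob (A m \<inter> A N)) + prob (A N)"
    using int_sq by (simp add: Bochner_Integration.integral_add Bochner_Integration.integral_sum
        Bochner_Integration.integrable_sum sets.sets_into_space Int_absorb2 Int_absorb1 le_infI1)
  also have "(\<Sum>m<N. prob (A m \<inter> A N)) \<le> (\<Sum>m<N. prob (A m) * prob (A N) + c (N - m) * prob (A N))"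
    by (intro sum_mono corr) auto
  also have "\<dots> = (?E + (\<Sum>m<N. c (N - m))) * prob (A N)"
    by (simp add: sum.distrib sum_distrib_right distrib_right)
  also have "\<dots> \<le> (?E + suminf c) * prob (A N)"
  proof -
    \<comment> \<open>the gaps \<open>N - m\<close> run through each value in \<open>{1..N}\<close> exactly once\<close>
    have "(\<Sum>m<N. c (N - m)) = (\<Sum>k\<in>{1..N}. c k)"
      by (rule sum.reindex_bij_witness[of _ "\<lambda>k. N - k" "\<lambda>m. N - m"]) auto
    also have "\<dots> \<le> suminf c"
      using c by (intro sum_le_suminf) auto
    finally show ?thesis by (intro mult_right_mono add_left_mono) auto
  qed
  finally have "expectation (\<lambda>x. (?S (Suc N) x)\<^sup>2)
      \<le> expectation (\<lambda>x. (?S N x)\<^sup>2) + 2 * ((?E + suminf c) * prob (A N)) + prob (A N)"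
    by simp
  also have "\<dots> \<le> ?E\<^sup>2 + (1 + 2 * suminf c) * ?E + 2 * ((?E + suminf c) * prob (A N)) + prob (A N)"
    using Suc.IH by simp
  also have "\<dots> \<le> (?E + prob (A N))\<^sup>2 + (1 + 2 * suminf c) * (?E + prob (A N))"
    by (simp add: power2_sum algebra_simps)
  finally show ?case by simp
qed simp

lemma (in prob_space) variance_count_le:
  fixes A :: "nat \<Rightarrow> 'a set" and c :: "nat \<Rightarrow> real"
  assumes A [measurable]: "\<And>n. A n \<in> events"
    and c: "summable c" "\<And>k. c k \<ge> 0"
    and corr: "\<And>m n. m < n \<Longrightarrow> prob (A m \<inter> A n) \<le> prob (A m) * prob (A n) + c (n - m) * prob (A n)"
  defines "S \<equiv> (\<lambda>N x. (\<Sum>n<N. indicator (A n) x) :: real)"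
  shows "expectation (S N) = (\<Sum>n<N. prob (A n))"
    and "integrable M (\<lambda>x. (S N x)\<^sup>2)"
    and "variance (S N) \<le> (1 + 2 * suminf c) * (\<Sum>n<N. prob (A n))"
proof -
  have [simp]: "integrable M (\<lambda>x. indicator (A n) x :: real)" for n
    by (rule integrable_real_indicator) (auto simp: emeasure_eq_measure)
  show E: "expectation (S N) = (\<Sum>n<N. prob (A n))"
    by (simp add: S_def sets.sets_into_space Int_absorb2)
  show sq: "integrable M (\<lambda>x. (S N x)\<^sup>2)"
    unfolding S_def using A by (rule integrable_count_squared)
  have "integrable M (S N)" by (simp add: S_def)
  then show "variance (S N) \<le> (1 + 2 * suminf c) * (\<Sum>n<N. prob (A n))"
    using second_moment_count_le[OF A c corr, of N] sq
    by (subst variance_eq) (auto simp: E, simp add: S_def)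
qed

text \<open>
  If only finitely many events occur at \<open>x\<close>, then the counts at \<open>x\<close> stay below some \<open>L\<close>. For
  fixed \<open>L\<close> this forces \<open>S\<^sub>N\<close> to deviate from \<open>E\<^sub>N\<close> by at least \<open>E\<^sub>N / 2\<close> as soon as
  \<open>E\<^sub>N > 2 L\<close>, which has probability at most a constant divided by \<open>E\<^sub>N\<close>.
\<close>

lemma (in prob_space) borel_cantelli_summable_correlation:
  fixes A :: "nat \<Rightarrow> 'a set" and c :: "nat \<Rightarrow> real"
  assumes A [measurable]: "\<And>n. A n \<in> events"
    and c: "summable c" "\<And>k. c k \<ge> 0"
    and corr: "\<And>m n. m < n \<Longrightarrow> prob (A m \<inter> A n) \<le> prob (A m) * prob (A n) + c (n - m) * prob (A n)"
    and div: "\<not> summable (\<lambda>n. prob (A n))"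
  shows "AE x in M. infinite {n. x \<in> A n}"
proof -
  define S :: "nat \<Rightarrow> 'a \<Rightarrow> real" where "S = (\<lambda>N x. \<Sum>n<N. indicator (A n) x)"
  define E where "E = (\<lambda>N. \<Sum>n<N. prob (A n))"
  define K where "K = 1 + 2 * suminf c"
  have [measurable]: "S N \<in> borel_measurable M" for N by (simp add: S_def)
  have E_top: "filterlim E at_top sequentially"
  proof -
    have "incseq E"
      by (auto intro!: incseq_SucI simp: E_def)
    moreover have "\<not> (\<exists>b. \<forall>N. E N \<le> b)"
      using div bounded_imp_summable[of "\<lambda>n. prob (A n)"]
      by (metis E_def measure_nonneg lessThan_Suc_atMost)
    ultimately show ?thesis
      unfolding filterlim_at_top eventually_sequentially incseq_def
      by (meson linear order_trans)
  qed
  have "AE x in M. \<not> (\<forall>N. S N x \<le> real L)" for L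
  proof -
    define Z where "Z = {x \<in> space M. \<forall>N. S N x \<le> real L}"
    have [measurable]: "Z \<in> events" unfolding Z_def by measurable
    have bound: "eventually (\<lambda>N. prob Z \<le> 4 * K / E N) sequentially"
    proof -
      \<comment> \<open>the summand 1 keeps \<open>E N\<close> positive when \<open>L = 0\<close>, as Chebyshev's inequality requires\<close>
      have "eventually (\<lambda>N. E N \<ge> 2 * real L + 1) sequentially"
        using E_top by (auto simp: filterlim_at_top)
      then show ?thesis
      proof eventually_elim
        case (elim N)
        have pos: "E N > 0" using elim by linarith
        have exp: "expectation (S N) = E N"
          using variance_count_le(1)[OF A c corr] by (simp add: S_def E_def)
        have "Z \<subseteq> {x \<in> space M. E N / 2 \<le> \<bar>S N x - expectation (S N)\<bar>}"
          using elim by (auto simp: Z_def exp abs_if field_simps dest!: spec[of _ N])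
        then have "prob Z \<le> prob {x \<in> space M. E N / 2 \<le> \<bar>S N x - expectation (S N)\<bar>}"
          by (intro finite_measure_mono) auto
        also have "\<dots> \<le> variance (S N) / (E N / 2)\<^sup>2"
          using pos variance_count_le(2)[OF A c corr]
          by (intro Chebyshev_inequality) (auto simp: S_def)
        also have "\<dots> \<le> K * E N / (E N / 2)\<^sup>2"
          using variance_count_le(3)[OF A c corr, of N]
          by (intro divide_right_mono) (auto simp: S_def E_def K_def)
        also have "\<dots> = 4 * K / E N" using pos by (simp add: power2_eq_square field_simps)
        finally show ?case .
      qed
    qed
    have "(\<lambda>N. 4 * K / E N) \<longlonglongrightarrow> 0"
      by (rule real_tendsto_divide_at_top[OF tendsto_const E_top])
    then have "prob Z \<le> 0"
      by (rule tendsto_lowerbound) (use bound in auto)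
    then have "prob Z = 0" by (simp add: measure_le_0_iff)
    then have "Z \<in> null_sets M" by (intro null_setsI) (auto simp: emeasure_eq_measure)
    then show ?thesis by (rule AE_I') (auto simp: Z_def)
  qed
  then have "AE x in M. \<forall>L. \<not> (\<forall>N. S N x \<le> real L)" by (simp add: AE_all_countable)
  then show ?thesis
  proof eventually_elim
    case (elim x)
    show ?case
    proof
      assume fin: "finite {n. x \<in> A n}"
      have "S N x \<le> real (card {n. x \<in> A n})" for N
      proof -
        have "S N x = real (card ({..<N} \<inter> {n. x \<in> A n}))"
          unfolding S_def by (subst sum.inter_restrict[symmetric, simplified] | simp add: indicator_def sum.If_cases)+
        then show ?thesis using fin by (simp add: card_mono)
      qed
      with elim show False by blast
    qed
  qed
qed

section \<open>Shrinking targets\<close>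

lemma pmp_system_funpow:
  assumes "pmp_system M T"
  shows "T ^^ n \<in> measurable M M"
    and "F \<in> sets M \<Longrightarrow> measure M ((T ^^ n) -` F \<inter> space M) = measure M F"
proof -
  have T: "T \<in> measurable M M"
    and inv: "\<And>F. F \<in> sets M \<Longrightarrow> measure M (T -` F \<inter> space M) = measure M F"
    using assms by (auto simp: pmp_system_def)
  show meas: "T ^^ n \<in> measurable M M" for n
    by (rule measurable_compose_n[OF T])
  show "F \<in> sets M \<Longrightarrow> measure M ((T ^^ n) -` F \<inter> space M) = measure M F"
  proof (induction n arbitrary: F)
    case (Suc n)
    have "(T ^^ Suc n) -` F \<inter> space M = (T ^^ n) -` (T -` F \<inter> space M) \<inter> space M"
      using measurable_space[OF meas[of n]] by auto
    then show ?case
      using Suc.IH[of "T -` F \<inter> space M"] Suc.prems inv measurable_sets[OF T] by metis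
  qed (simp add: Int_absorb2 sets.sets_into_space)
qed

lemma ball_in_borel_sigma_sets:
  assumes "Metric_space X d"
    and "bl = Metric_space.mball X d \<or> bl = Metric_space.mcball X d"
  shows "bl x r \<in> sigma_sets X {U. openin (Metric_space.mtopology X d) U}"
proof -
  interpret Metric_space X d by fact
  have "mcball x r = X - (X - mcball x r)" using mcball_subset_mspace by auto
  moreover have "openin mtopology (X - mcball x r)"
    using closedin_mcball[of x r] by (simp add: closedin_def)
  ultimately have "mcball x r \<in> sigma_sets X {U. openin mtopology U}"
    by (metis sigma_sets.Basic sigma_sets.Compl mem_Collect_eq)
  then show ?thesis using assms(2) by (auto intro: sigma_sets.Basic)
qed

theorem theorem3p2:
  fixes X :: "'a set" and d :: "'a \<Rightarrow> 'a \<Rightarrow> real"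
    and M :: "'a measure" and T :: "'a \<Rightarrow> 'a"
    and bl :: "'a \<Rightarrow> real \<Rightarrow> 'a set"
    and \<psi> :: "nat \<Rightarrow> real" and x0 :: 'a
  assumes "Metric_space X d"
    and "compact_space (Metric_space.mtopology X d)"
    and "bl = Metric_space.mball X d \<or> bl = Metric_space.mcball X d"
    and "space M = X"
    and "sigma_sets X {U. openin (Metric_space.mtopology X d) U} \<subseteq> sets M"
    and "pmp_system M T"
    and "exponentially_mixing bl M T"
    and "\<And>n. n \<ge> 1 \<Longrightarrow> \<psi> n \<ge> 0"
    and "x0 \<in> X"
  shows "shrinking_target_set bl X T x0 \<psi> \<in> sets M \<and>
    ((\<Sum>n. emeasure M (bl x0 (\<psi> (Suc n)))) < \<infinity> \<longrightarrow>
       measure M (shrinking_target_set bl X T x0 \<psi>) = 0) \<and>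
    ((\<Sum>n. emeasure M (bl x0 (\<psi> (Suc n)))) = \<infinity> \<longrightarrow>
       measure M (shrinking_target_set bl X T x0 \<psi>) = 1)"
proof -
  interpret prob_space M using assms(6) by (simp add: pmp_system_def)
  \<comment> \<open>times start at 1, indices of the sequence of events at 0\<close>
  define B where "B = (\<lambda>n. bl x0 (\<psi> (Suc n)))"
  define A where "A = (\<lambda>n. (T ^^ Suc n) -` B n \<inter> space M)"
  let ?W = "shrinking_target_set bl X T x0 \<psi>"
  have B: "B n \<in> events" for n
    using ball_in_borel_sigma_sets[OF assms(1,3)] assms(5) by (auto simp: B_def)
  have A [measurable]: "A n \<in> events" for n
    unfolding A_def by (rule measurable_sets[OF pmp_system_funpow(1)[OF assms(6)] B])
  have prob_A: "prob (A n) = prob (B n)" for n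
    unfolding A_def by (rule pmp_system_funpow(2)[OF assms(6) B])
  have emeasure_A: "emeasure M (A n) = emeasure M (B n)" for n
    by (simp add: emeasure_eq_measure prob_A)
  have W: "?W = {x \<in> space M. infinite {n. x \<in> A n}}"
  proof -
    have "infinite {n. n \<ge> 1 \<and> (T ^^ n) x \<in> bl x0 (\<psi> n)} \<longleftrightarrow> infinite {n. x \<in> A n}"
      if "x \<in> space M" for x
    proof -
      have "{n. n \<ge> 1 \<and> (T ^^ n) x \<in> bl x0 (\<psi> n)} = Suc ` {n. x \<in> A n}"
      proof (rule set_eqI)
        show "n \<in> {n. n \<ge> 1 \<and> (T ^^ n) x \<in> bl x0 (\<psi> n)} \<longleftrightarrow> n \<in> Suc ` {n. x \<in> A n}" for n
          using that by (cases n) (auto simp: A_def B_def)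
      qed
      then show ?thesis by (simp add: finite_image_iff)
    qed
    then show ?thesis using assms(4) by (auto simp: shrinking_target_set_def)
  qed
  have W_meas: "?W \<in> events"
  proof -
    have "?W = {x \<in> space M. \<forall>m. \<exists>n\<in>{m..}. x \<in> A n}"
      unfolding W by (auto simp: infinite_nat_iff_unbounded_le)
    also have "\<dots> \<in> events" by measurable
    finally show ?thesis .
  qed
  moreover have "prob ?W = 0" if "(\<Sum>n. emeasure M (bl x0 (\<psi> (Suc n)))) < \<infinity>"
  proof -
    have "(\<Sum>n. emeasure M (A n)) < \<infinity>" using that by (simp add: emeasure_A B_def)
    then have "AE x in M. eventually (\<lambda>n. x \<in> space M - A n) sequentially"
      by (intro borel_cantelli_AE1) (auto simp: emeasure_eq_measure intro!: summable_suminf_not_top)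
    then have "AE x in M. x \<notin> ?W"
    proof eventually_elim
      case (elim x)
      then have "finite {n. x \<in> A n}"
        by (auto simp: cofinite_eq_sequentially[symmetric] eventually_cofinite elim: rev_finite_subset)
      then show ?case by (simp add: W)
    qed
    then show ?thesis using W_meas by (simp add: prob_eq_0)
  qed
  moreover have "prob ?W = 1" if inf: "(\<Sum>n. emeasure M (bl x0 (\<psi> (Suc n)))) = \<infinity>"
  proof -
    obtain C \<gamma> where C: "C > 0" "0 < \<gamma>" "\<gamma> < 1" and
      mix: "\<And>n x r F. n \<ge> 1 \<Longrightarrow> x \<in> space M \<Longrightarrow> r \<ge> 0 \<Longrightarrow> F \<in> events \<Longrightarrow>
        \<bar>prob (bl x r \<inter> ((T ^^ n) -` F \<inter> space M)) - prob F * prob (bl x r)\<bar> \<le> C * \<gamma> ^ n * prob F"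
      using assms(7) unfolding exponentially_mixing_def by metis
    \<comment> \<open>the earlier target is the ball of the mixing estimate, the later one its measurable set\<close>
    have "prob (A m \<inter> A n) \<le> prob (A m) * prob (A n) + C * \<gamma> ^ (n - m) * prob (A n)"
      if "m < n" for m n
    proof -
      have split: "(T ^^ Suc n) x = (T ^^ (n - m)) ((T ^^ Suc m) x)" for x
        using that by (metis Suc_diff_le Suc_diff_Suc add_Suc_right comp_apply funpow_add
            le_add_diff_inverse2 less_imp_le_nat)
      let ?F = "B m \<inter> ((T ^^ (n - m)) -` B n \<inter> space M)"
      have F: "?F \<in> events"
        using B measurable_sets[OF pmp_system_funpow(1)[OF assms(6)] B] by blast
      have "A m \<inter> A n = (T ^^ Suc m) -` ?F \<inter> space M"
        unfolding A_def using measurable_space[OF pmp_system_funpow(1)[OF assms(6)], of _ "Suc m"]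
        by (auto simp: split simp del: funpow.simps)
      then have "prob (A m \<inter> A n) = prob ?F"
        using pmp_system_funpow(2)[OF assms(6) F] by metis
      also have "\<dots> \<le> prob (B n) * prob (B m) + C * \<gamma> ^ (n - m) * prob (B n)"
      proof -
        have "\<bar>prob ?F - prob (B n) * prob (B m)\<bar> \<le> C * \<gamma> ^ (n - m) * prob (B n)"
          unfolding B_def[THEN fun_cong, of m]
          using that B assms(4,8,9) by (intro mix) auto
        then show ?thesis by linarith
      qed
      finally show ?thesis by (simp add: prob_A mult.commute)
    qed
    moreover have "summable (\<lambda>k. C * \<gamma> ^ k)" using C by simp
    moreover have "\<not> summable (\<lambda>n. prob (A n))"
    proof
      assume "summable (\<lambda>n. prob (A n))"
      then have "(\<Sum>n. emeasure M (A n)) = ennreal (\<Sum>n. prob (A n))"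
        by (simp add: emeasure_eq_measure suminf_ennreal2)
      with inf show False by (simp add: emeasure_A B_def)
    qed
    ultimately have "AE x in M. infinite {n. x \<in> A n}"
      using C by (intro borel_cantelli_summable_correlation[where c = "\<lambda>k. C * \<gamma> ^ k"]) auto
    then have "AE x in M. x \<in> ?W" using AE_space by eventually_elim (simp add: W)
    then show ?thesis using W_meas by (simp add: prob_eq_1)
  qed
  ultimately show ?thesis by blast
qed

end
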